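(* For all integers $n\geq 1$ and $m\geq 3$, $$\beta(K_n\,\square\,C_m)=\begin{cases}2, & \text{if } n=1,\\ 2, & \text{if } n=2 \text{ and } m \text{ is odd},\\ 3, & \text{if } n=2 \text{ and } m \text{ is even},\\ 3, & \text{if } n=3,\\ 3, & \text{if } n=4 \text{ and } m \text{ is even},\\ 4, & \text{if } n=4 \text{ and } m \text{ is odd},\\ n-1, & \text{if } n\geq 5.\end{cases}$$
   Context: $K_n$ is the complete graph on $n$ vertices and $C_m$ the cycle on $m$ vertices. $d(v,w)$ denotes shortest-path distance. A vertex $x$ resolves $v,w$ if $d(v,x)\neq d(w,x)$; a set resolves a graph if every pair of distinct vertices is resolved by some vertex of the set; $\beta(G)$ is the minimum size of a resolving set. The cartesian product $G\,\square\,H$ has vertex set $V(G)\times V(H)$, with $(a,v)\sim(b,w)$ iff ($a=b$ and $vw\in E(H)$) or ($v=w$ and $ab\in E(G)$). *)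

theory Defs
  imports "Graph_Theory.Graph_Theory"
begin

text \<open>
  Undirected simple graphs are symmetric loop-free digraphs on pairs (the locale
  \<open>pair_graph\<close>): the edge between \<open>u\<close> and \<open>v\<close> is the pair of arcs \<open>(u, v)\<close> and \<open>(v, u)\<close>.
\<close>

definition complete_graph :: "nat \<Rightarrow> nat pair_pre_digraph" where
  "complete_graph n =
    \<lparr> pverts = {0..<n}, parcs = {(i, j). i < n \<and> j < n \<and> i \<noteq> j} \<rparr>"

text \<open>Meaningful for \<open>m \<ge> 3\<close> only; in particular \<open>cycle_graph 1\<close> has a loop.\<close>

definition cycle_graph :: "nat \<Rightarrow> nat pair_pre_digraph" where
  "cycle_graph m =
    \<lparr> pverts = {0..<m},
      parcs = {(i, j). i < m \<and> j < m \<and> (j = (i + 1) mod m \<or> i = (j + 1) mod m)} \<rparr>"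

definition cartesian_product ::
  "'a pair_pre_digraph \<Rightarrow> 'b pair_pre_digraph \<Rightarrow> ('a \<times> 'b) pair_pre_digraph"
  (infixl \<open>\<box>\<close> 70) where
  "G \<box> H =
    \<lparr> pverts = pverts G \<times> pverts H,
      parcs = {((a, v), (b, w)).
        (a = b \<and> a \<in> pverts G \<and> (v, w) \<in> parcs H) \<or>
        (v = w \<and> v \<in> pverts H \<and> (a, b) \<in> parcs G)} \<rparr>"

definition graph_dist :: "'a pair_pre_digraph \<Rightarrow> 'a \<Rightarrow> 'a \<Rightarrow> ereal" where
  "graph_dist G v w = wf_digraph.\<mu> (with_proj G) (\<lambda>_. 1) v w"

definition resolves :: "'a pair_pre_digraph \<Rightarrow> 'a \<Rightarrow> 'a \<Rightarrow> 'a \<Rightarrow> bool" where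
  "resolves G x v w \<longleftrightarrow> graph_dist G v x \<noteq> graph_dist G w x"

definition resolving_set :: "'a pair_pre_digraph \<Rightarrow> 'a set \<Rightarrow> bool" where
  "resolving_set G S \<longleftrightarrow> S \<subseteq> pverts G \<and>
    (\<forall>v\<in>pverts G. \<forall>w\<in>pverts G. v \<noteq> w \<longrightarrow> (\<exists>x\<in>S. resolves G x v w))"

text \<open>
  Intended for finite graphs, where a finite resolving set always exists (the whole
  vertex set).
\<close>

definition metric_dimension :: "'a pair_pre_digraph \<Rightarrow> nat" where
  "metric_dimension G = (LEAST k. \<exists>S. finite S \<and> resolving_set G S \<and> card S = k)"

lemma pair_graphI:
  assumes "finite (pverts G)" "parcs G \<subseteq> pverts G \<times> pverts G"
    and "sym (parcs G)" "irrefl (parcs G)"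
  shows "pair_graph G"
proof -
  have "finite (parcs G)"
    using assms by (meson finite_SigmaI finite_subset)
  then show ?thesis
    using assms by unfold_locales (auto simp: symmetric_def irrefl_def)
qed

lemma pair_graph_complete_graph: "pair_graph (complete_graph n)"
  by (rule pair_graphI) (auto simp: complete_graph_def sym_def irrefl_def)

lemma complete_digraph_complete_graph: "K\<^bsub>n\<^esub> (with_proj (complete_graph n))"
  by (auto simp: complete_digraph_pair_def pair_graph_complete_graph)
    (auto simp: complete_graph_def)

lemma pair_graph_cycle_graph:
  assumes "m \<ge> 3"
  shows "pair_graph (cycle_graph m)"
proof (rule pair_graphI)
  have "i \<noteq> Suc i mod m" if "i < m" for i
    using assms that by (cases "Suc i = m") auto
  then show "irrefl (parcs (cycle_graph m))"
    by (auto simp: cycle_graph_def irrefl_def)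
qed (auto simp: cycle_graph_def sym_def)

lemma pair_graph_cartesian_product:
  assumes "pair_graph G" "pair_graph H"
  shows "pair_graph (G \<box> H)"
proof -
  interpret G: pair_graph G by fact
  interpret H: pair_graph H by fact
  show ?thesis
  proof (rule pair_graphI)
    show "finite (pverts (G \<box> H))"
      by (simp add: cartesian_product_def G.pair_finite_verts H.pair_finite_verts)
    show "parcs (G \<box> H) \<subseteq> pverts (G \<box> H) \<times> pverts (G \<box> H)"
      by (auto simp: cartesian_product_def dest: G.wellformed' H.wellformed')
    show "sym (parcs (G \<box> H))"
      using G.pair_sym_arcs H.pair_sym_arcs
      by (auto simp: cartesian_product_def symmetric_def sym_def)
    show "irrefl (parcs (G \<box> H))"
      using G.pair_no_loops H.pair_no_loops
      by (fastforce simp: cartesian_product_def irrefl_def)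
  qed
qed

lemma graph_dist_eq_INF_length:
  assumes "pair_graph G"
  shows "graph_dist G v w =
    (INF p\<in>{p. pre_digraph.awalk (with_proj G) v p w}. ereal (real (length p)))"
proof -
  interpret pair_graph G by fact
  have "awalk_cost (\<lambda>_. 1) p = real (length p)" for p :: "('a \<times> 'a) list"
    by (induction p) auto
  then show ?thesis
    by (simp add: graph_dist_def \<mu>_def)
qed

end

theory Submission
  imports Defs
begin

text \<open>
  The distance between \<open>(a, u)\<close> and \<open>(b, v)\<close> is \<open>[a \<noteq> b] + d(u, v)\<close> with \<open>d\<close> the cycle distance.
  Two rows without an element of \<open>S\<close> cannot be separated, so a resolving set misses at most one
  row; for small \<open>n\<close> this leaves few candidates, each defeated by an explicit unresolved pair.
  For \<open>n = 4\<close> and \<open>m = 2r + 1\<close> three elements lie in distinct rows. If their columns are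
  distinct, one of the columns \<open>k\<close> has the other two in different halves of the cycle as seen
  from \<open>k\<close>, and the edge opposite to \<open>k\<close> yields an unresolved pair in the rows of those two.

  Conversely, \<open>{(a, a mod 2) | a < N}\<close> resolves the product of \<open>K\<^sub>N\<close> and \<open>C\<^sub>m\<close> when
  \<open>N \<ge> 3\<close>: columns 0 and 1 together determine a vertex within its row. If \<open>(a, u)\<close> and \<open>(b, v)\<close>
  with \<open>a \<noteq> b\<close> had equal distances to the element \<open>(a, p)\<close>, then \<open>d(u, p) = d(v, p) + 1\<close>, which is
  refuted by any further element in column \<open>p\<close>. One more row is allowed when each parity
  class of rows has two members, or when \<open>C\<^sub>m\<close> is bipartite.
\<close>

section \<open>Graph distance from a potential function\<close>

text \<open>\<open>lip\<close> bounds every walk to \<open>w\<close> from below, since the potential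
  drops by at most one per arc. \<open>step\<close> and \<open>zero\<close> let one descend in unit
  steps to \<open>w\<close>, which gives a walk attaining the bound.\<close>

lemma graph_dist_eqI:
  assumes G: "pair_graph G" and v: "v \<in> pverts G"
    and lip: "\<And>x y. (x, y) \<in> parcs G \<Longrightarrow> D x \<le> Suc (D y)"
    and step: "\<And>x. x \<in> pverts G \<Longrightarrow> D x \<noteq> 0 \<Longrightarrow> \<exists>y. (x, y) \<in> parcs G \<and> D x = Suc (D y)"
    and zero: "\<And>x. x \<in> pverts G \<Longrightarrow> D x = 0 \<longleftrightarrow> x = w"
  shows "graph_dist G v w = ereal (real (D v))"
proof -
  interpret pair_graph G by fact
  have lower: "D x \<le> length p" if "awalk x p w" for x p
    using that
  proof (induction p arbitrary: x)
    case Nil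
    then show ?case using zero by (auto simp: awalk_Nil_iff)
  next
    case (Cons e p)
    then show ?case
      using lip[of "fst e" "snd e"] by (fastforce simp: awalk_Cons_iff)
  qed
  have upper: "\<exists>p. awalk x p w \<and> length p = D x" if "x \<in> pverts G" for x
    using that
  proof (induction "D x" arbitrary: x)
    case 0
    then show ?case using zero by (auto simp: awalk_Nil_iff intro!: exI[of _ "[]"])
  next
    case (Suc k)
    then obtain y where y: "(x, y) \<in> parcs G" "D x = Suc (D y)"
      using step by (metis Zero_not_Suc)
    then obtain p where "awalk y p w" "length p = D y"
      using Suc by (metis Suc_inject wellformed'(2))
    then show ?case
      using y by (intro exI[of _ "(x, y) # p"]) (auto simp: awalk_Cons_iff)
  qed
  show ?thesis
    unfolding graph_dist_eq_INF_length[OF G]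
  proof (rule antisym)
    show "(INF p\<in>{p. awalk v p w}. ereal (real (length p))) \<le> ereal (real (D v))"
      using upper[OF v] by (auto intro: INF_lower2)
    show "ereal (real (D v)) \<le> (INF p\<in>{p. awalk v p w}. ereal (real (length p)))"
      using lower by (auto intro!: INF_greatest)
  qed
qed

section \<open>Distances in the cycle\<close>

definition cycle_dist :: "nat \<Rightarrow> nat \<Rightarrow> nat \<Rightarrow> nat" where
  "cycle_dist m u v =
    (if u \<le> v then min (v - u) (m - (v - u)) else min (u - v) (m - (u - v)))"

text \<open>Removes \<open>min\<close> and truncated subtraction, so that facts about distances
  become linear arithmetic. The bound \<open>2 * d \<le> m\<close> selects the shorter arc; the
  equations containing \<open>+ m\<close> cover arcs that pass from \<open>m - 1\<close> to
  0.\<close>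

lemma cycle_dist_eq_iff:
  assumes "u < m" "v < m"
  shows "cycle_dist m u v = d \<longleftrightarrow>
    2 * d \<le> m \<and> (v = u + d \<or> u = v + d \<or> v + m = u + d \<or> u + m = v + d)"
  using assms by (cases "u \<le> v") (auto simp: cycle_dist_def min_def)

lemma cycle_dist_eq_0_iff: "u < m \<Longrightarrow> v < m \<Longrightarrow> cycle_dist m u v = 0 \<longleftrightarrow> u = v"
  by (auto simp: cycle_dist_eq_iff)

lemma cycle_dist_refl [simp]: "cycle_dist m u u = 0"
  by (simp add: cycle_dist_def)

lemma cycle_graph_arc_iff:
  assumes "u < m" "v < m"
  shows "(u, v) \<in> parcs (cycle_graph m) \<longleftrightarrow>
    v = u + 1 \<or> u = v + 1 \<or> v + m = u + 1 \<or> u + m = v + 1"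
proof -
  have "y = (x + 1) mod m \<longleftrightarrow> y = x + 1 \<or> y + m = x + 1" if "x < m" "y < m" for x y
    using that by (cases "x + 1 = m") auto
  then show ?thesis
    using assms by (auto simp: cycle_graph_def)
qed

lemma cycle_dist_le_Suc:
  assumes "(x, y) \<in> parcs (cycle_graph m)" "v < m"
  shows "cycle_dist m x v \<le> Suc (cycle_dist m y v)"
proof -
  have b: "x < m" "y < m"
    using assms by (auto simp: cycle_graph_def)
  note arc = assms(1)[unfolded cycle_graph_arc_iff[OF b]]
  define d e where "d = cycle_dist m y v" and "e = cycle_dist m x v"
  then have "2 * d \<le> m \<and> (v = y + d \<or> y = v + d \<or> v + m = y + d \<or> y + m = v + d)"
    and "2 * e \<le> m \<and> (v = x + e \<or> x = v + e \<or> v + m = x + e \<or> x + m = v + e)"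
    using b assms(2) cycle_dist_eq_iff by metis+
  then have "e \<le> Suc d"
    using arc b assms(2) by linarith
  then show ?thesis by (simp add: d_def e_def)
qed

lemma cycle_dist_arc:
  assumes "(x, y) \<in> parcs (cycle_graph m)" "m \<ge> 3"
  shows "cycle_dist m y x = 1"
proof -
  have b: "x < m" "y < m"
    using assms by (auto simp: cycle_graph_def)
  show ?thesis
    using assms(1)[unfolded cycle_graph_arc_iff[OF b]] b assms(2)
    by (auto simp: cycle_dist_eq_iff)
qed

lemma cycle_dist_step:
  assumes "u < m" "v < m" "u \<noteq> v"
  shows "\<exists>x. (u, x) \<in> parcs (cycle_graph m) \<and> cycle_dist m u v = Suc (cycle_dist m x v)"
proof -
  define s where "s = (if u = m - 1 then 0 else Suc u)"
  define t where "t = (if u = 0 then m - 1 else u - 1)"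
  have arcs: "(u, s) \<in> parcs (cycle_graph m)" "(u, t) \<in> parcs (cycle_graph m)"
    using assms(1) by (auto simp: cycle_graph_arc_iff s_def t_def)
  obtain d where d: "cycle_dist m u v = Suc d"
    using assms cycle_dist_eq_0_iff not0_implies_Suc by metis
  have st: "s < m" "t < m"
    using assms(1) by (auto simp: s_def t_def)
  \<comment> \<open>A shortest arc from \<open>u\<close> to \<open>v\<close> runs either upwards,
    with first step to \<open>s\<close>, or downwards, with first step to \<open>t\<close>.\<close>
  consider "v = u + Suc d \<or> v + m = u + Suc d" | "u = v + Suc d \<or> u + m = v + Suc d"
    using d[unfolded cycle_dist_eq_iff[OF assms(1,2)]] by blast
  then have "cycle_dist m s v = d \<or> cycle_dist m t v = d"
  proof cases
    case 1
    have "2 * Suc d \<le> m"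
      using d assms by (simp add: cycle_dist_eq_iff)
    then have "cycle_dist m s v = d"
      unfolding cycle_dist_eq_iff[OF st(1) assms(2)]
      using 1 assms by (cases "u = m - 1") (auto simp: s_def)
    then show ?thesis ..
  next
    case 2
    have "2 * Suc d \<le> m"
      using d assms by (simp add: cycle_dist_eq_iff)
    then have "cycle_dist m t v = d"
      unfolding cycle_dist_eq_iff[OF st(2) assms(2)]
      using 2 assms by (cases "u = 0") (auto simp: t_def)
    then show ?thesis ..
  qed
  then show ?thesis using arcs d by metis
qed

text \<open>If the columns differed, equal distances to 0 would give v = -u and equal distances to 1
  would give v = 2 - u modulo \<open>m\<close>, hence 2 = 0 modulo \<open>m\<close>, contrary to
  \<open>m \<ge> 3\<close>.\<close>

lemma cycle_dist_0_1_inject: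
  assumes "m \<ge> 3" "u < m" "v < m"
    and "cycle_dist m u 0 = cycle_dist m v 0" "cycle_dist m u 1 = cycle_dist m v 1"
  shows "u = v"
proof -
  define d e where "d = cycle_dist m v 0" and "e = cycle_dist m v 1"
  then have "cycle_dist m u 0 = d" "cycle_dist m v 0 = d" "cycle_dist m u 1 = e" "cycle_dist m v 1 = e"
    using assms(4,5) by simp_all
  moreover have "0 < m" "1 < m"
    using assms(1) by simp_all
  ultimately show ?thesis
    using assms(1-3) by (simp only: cycle_dist_eq_iff) linarith
qed

text \<open>The bipartition of an even cycle: wrapping around changes a difference by the even
  number \<open>m\<close>, so parity survives.\<close>

lemma even_cycle_dist:
  assumes "even m" "u < m" "v < m"
  shows "even (cycle_dist m u v) \<longleftrightarrow> even (u + v)"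
proof -
  define d where "d = cycle_dist m u v"
  then have "v = u + d \<or> u = v + d \<or> v + m = u + d \<or> u + m = v + d"
    using cycle_dist_eq_iff[OF assms(2,3), of d] by blast
  then have "even (u + v + d)"
    using assms(1) by (metis even_add)
  then show ?thesis by (simp add: d_def)
qed

section \<open>Columns used to build unresolved pairs\<close>

lemma cycle_neighbours:
  fixes m u :: nat
  assumes "m \<ge> 3" "u < m"
  obtains s t where "s < m" "t < m" "s \<noteq> t"
    "s = u + 1 \<or> s + m = u + 1" "u = t + 1 \<or> u + m = t + 1"
  using assms
  by (intro that[of "if u = m - 1 then 0 else u + 1" "if u = 0 then m - 1 else u - 1"]) auto

lemma cycle_dist_two_neighbours:
  assumes "m \<ge> 3" "u < m"
  shows "\<exists>p q. p < m \<and> q < m \<and> p \<noteq> q \<and> cycle_dist m p u = 1 \<and> cycle_dist m q u = 1"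
proof -
  obtain s t where st: "s < m" "t < m" "s \<noteq> t"
    "s = u + 1 \<or> s + m = u + 1" "u = t + 1 \<or> u + m = t + 1"
    using cycle_neighbours[OF assms] by blast
  then have "cycle_dist m s u = 1" "cycle_dist m t u = 1"
    using assms by (simp_all only: cycle_dist_eq_iff) linarith+
  then show ?thesis using st by blast
qed

text \<open>If \<open>i\<close> and \<open>j\<close> are antipodal, both neighbours of
  \<open>i\<close> are one step closer to \<open>j\<close>. Otherwise the neighbour of
  \<open>i\<close> facing away from \<open>j\<close> is one step farther. Either outcome defeats two
  elements placed in one row.\<close>

lemma even_cycle_dist_pair:
  assumes "even m" "m \<ge> 3" "i < m" "j < m" "i \<noteq> j"
  obtains (antipodal) p q where "p < m" "q < m" "p \<noteq> q"
      "cycle_dist m p i = cycle_dist m q i" "cycle_dist m p j = cycle_dist m q j"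
    | (away) p where "p < m" "cycle_dist m p i = 1" "cycle_dist m p j = Suc (cycle_dist m i j)"
proof -
  obtain s t where st: "s < m" "t < m" "s \<noteq> t"
    "s = i + 1 \<or> s + m = i + 1" "i = t + 1 \<or> i + m = t + 1"
    using cycle_neighbours[OF assms(2,3)] by blast
  have one: "cycle_dist m s i = 1" "cycle_dist m t i = 1"
    using assms(2,3) st by (simp_all only: cycle_dist_eq_iff) linarith+
  obtain r where r: "m = 2 * r"
    using assms(1) by blast
  obtain d where d: "cycle_dist m i j = Suc d"
    using assms(3-5) cycle_dist_eq_0_iff not0_implies_Suc by metis
  note d' = d[unfolded cycle_dist_eq_iff[OF assms(3,4)]]
  show thesis
  proof (cases "2 * Suc d = m")
    case True
    then have m: "m = d + d + 2" by simp
    have ij: "j = i + d + 1 \<or> i = j + d + 1"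
      using d' unfolding m by (elim conjE disjE; simp)
    have "cycle_dist m s j = d"
      unfolding cycle_dist_eq_iff[OF st(1) assms(4)]
      using ij st(1,4) assms(3,4) unfolding m by (elim disjE; simp)
    moreover have "cycle_dist m t j = d"
      unfolding cycle_dist_eq_iff[OF st(2) assms(4)]
      using ij st(2,5) assms(3,4) unfolding m by (elim disjE; simp)
    ultimately have "cycle_dist m s j = d" "cycle_dist m t j = d" by blast+
    then show thesis using antipodal st one by metis
  next
    case False
    \<comment> \<open>Evenness matters here: a distance short of \<open>m / 2 = r\<close> leaves
      room for a whole further step, so the arc through the neighbour is still a shortest
      one.\<close>
    then have "Suc d < r"
      using d' r by simp
    then have le: "2 * Suc (Suc d) \<le> m"
      using r by simp
    consider "j = i + Suc d \<or> j + m = i + Suc d" | "i = j + Suc d \<or> i + m = j + Suc d"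
      using d' by blast
    then have "cycle_dist m s j = Suc (Suc d) \<or> cycle_dist m t j = Suc (Suc d)"
    proof cases
      case 1
      then have "cycle_dist m t j = Suc (Suc d)"
        unfolding cycle_dist_eq_iff[OF st(2) assms(4)]
        using le st(2,5) assms(3,4) by (elim disjE; simp)
      then show ?thesis ..
    next
      case 2
      then have "cycle_dist m s j = Suc (Suc d)"
        unfolding cycle_dist_eq_iff[OF st(1) assms(4)]
        using le st(1,4) assms(3,4) by (elim disjE; simp)
      then show ?thesis ..
    qed
    then show thesis using away st one d by metis
  qed
qed

text \<open>
  With \<open>m = 2r + 1\<close>: the column \<open>i\<close> is one of \<open>k + 1, \<dots>, k + r\<close> modulo \<open>m\<close>.
\<close>

definition half_cycle :: "nat \<Rightarrow> nat \<Rightarrow> nat \<Rightarrow> bool" where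
  "half_cycle r k i \<longleftrightarrow> k < i \<and> i \<le> k + r \<or> i + r < k"

text \<open>The three columns cut the cycle into gaps with sum 2r + 1, so at most one gap exceeds r.
  A column bounding no such gap has one of the others among the r columns ahead of it and the other
  among the r behind.\<close>

lemma half_cycle_separates:
  assumes "i < Suc (2 * r)" "j < Suc (2 * r)" "k < Suc (2 * r)" "i \<noteq> j" "i \<noteq> k" "j \<noteq> k"
  shows "half_cycle r k i \<noteq> half_cycle r k j \<or> half_cycle r i j \<noteq> half_cycle r i k \<or>
    half_cycle r j i \<noteq> half_cycle r j k"
  using assms unfolding half_cycle_def
  by (cases "i < j"; cases "j < k"; cases "i < k") auto

text \<open>The witnesses are k + r and k - r modulo \<open>m\<close>, which are adjacent and both
  at distance r from \<open>k\<close>. From \<open>v\<close> a column in the half ahead of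
  \<open>k\<close> is reached through \<open>u\<close>; from \<open>u\<close> a column in the other
  half is reached through \<open>v\<close>.\<close>

lemma odd_cycle_opposite_edge:
  assumes "m = Suc (2 * r)" "r > 0" "k < m"
  obtains u v where "u < m" "v < m" "u \<noteq> v" "cycle_dist m u k = cycle_dist m v k"
    and "\<And>i. i < m \<Longrightarrow> i \<noteq> k \<Longrightarrow> half_cycle r k i \<Longrightarrow> cycle_dist m v i = Suc (cycle_dist m u i)"
    and "\<And>i. i < m \<Longrightarrow> i \<noteq> k \<Longrightarrow> \<not> half_cycle r k i \<Longrightarrow> cycle_dist m u i = Suc (cycle_dist m v i)"
proof -
  obtain u where u: "u < m" "u = k + r \<or> u + m = k + r"
    using assms by (intro that[of "if k \<le> r then k + r else k - r - 1"]) auto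
  obtain v where v: "v < m" "k = v + r \<or> k + m = v + r"
    using assms by (intro that[of "if k < r then k + r + 1 else k - r"]) auto
  show thesis
  proof (rule that)
    show "u < m" "v < m" by fact+
    show "u \<noteq> v" using u v assms by linarith
    have "cycle_dist m u k = r" "cycle_dist m v k = r"
      using u v assms by (simp_all only: cycle_dist_eq_iff) linarith+
    then show "cycle_dist m u k = cycle_dist m v k" by simp
  next
    fix i assume i: "i < m" "i \<noteq> k" "half_cycle r k i"
    \<comment> \<open>\<open>e\<close> is the distance from \<open>k\<close> up to \<open>i\<close>;
      the remaining \<open>d\<close> = r - e is the distance from \<open>i\<close> on to
      \<open>u\<close>.\<close>
    obtain e where e: "0 < e" "e \<le> r" "i = k + e \<or> i + m = k + e"
      using i assms by (intro that[of "if k < i then i - k else i + m - k"]) (auto simp: half_cycle_def)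
    then obtain d where d: "r = e + d"
      using le_iff_add by blast
    have "cycle_dist m u i = d"
      unfolding cycle_dist_eq_iff[OF u(1) i(1)]
      using u e(1,3) d i(1) assms(1,3) by (elim disjE; simp)
    moreover have "cycle_dist m v i = Suc d"
      unfolding cycle_dist_eq_iff[OF v(1) i(1)]
      using v e(1,3) d i(1) assms(1,3) by (elim disjE; simp)
    ultimately show "cycle_dist m v i = Suc (cycle_dist m u i)" by simp
  next
    fix i assume i: "i < m" "i \<noteq> k" "\<not> half_cycle r k i"
    obtain e where e: "0 < e" "e \<le> r" "k = i + e \<or> k + m = i + e"
      using i assms by (intro that[of "if i < k then k - i else k + m - i"]) (auto simp: half_cycle_def)
    then obtain d where d: "r = e + d"
      using le_iff_add by blast
    have "cycle_dist m v i = d"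
      unfolding cycle_dist_eq_iff[OF v(1) i(1)]
      using v e(1,3) d i(1) assms(1,3) by (elim disjE; simp)
    moreover have "cycle_dist m u i = Suc d"
      unfolding cycle_dist_eq_iff[OF u(1) i(1)]
      using u e(1,3) d i(1) assms(1,3) by (elim disjE; simp)
    ultimately show "cycle_dist m u i = Suc (cycle_dist m v i)" by simp
  qed
qed

section \<open>Distances and resolving sets in the product\<close>

definition prism_dist :: "nat \<Rightarrow> nat \<times> nat \<Rightarrow> nat \<times> nat \<Rightarrow> nat" where
  "prism_dist m v w = of_bool (fst v \<noteq> fst w) + cycle_dist m (snd v) (snd w)"

lemma prism_dist_simp [simp]:
  "prism_dist m (a, u) (b, v) = of_bool (a \<noteq> b) + cycle_dist m u v"
  by (simp add: prism_dist_def)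

lemma pverts_prism [simp]:
  "pverts (complete_graph n \<box> cycle_graph m) = {0..<n} \<times> {0..<m}"
  by (simp add: cartesian_product_def complete_graph_def cycle_graph_def)

text \<open>The distance formula serves as the potential. A descending step switches to the row of
  \<open>w\<close> first and then follows the cycle inside that row.\<close>

lemma graph_dist_prism:
  assumes "m \<ge> 3" "v \<in> {0..<n} \<times> {0..<m}" "w \<in> {0..<n} \<times> {0..<m}"
  shows "graph_dist (complete_graph n \<box> cycle_graph m) v w = ereal (real (prism_dist m v w))"
proof (rule graph_dist_eqI)
  let ?G = "complete_graph n \<box> cycle_graph m"
  obtain b j where w: "w = (b, j)" "b < n" "j < m"
    using assms by auto
  show "pair_graph ?G"
    using assms by (intro pair_graph_cartesian_product pair_graph_complete_graph pair_graph_cycle_graph)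
  show "v \<in> pverts ?G"
    using assms by simp
  show "prism_dist m x w \<le> Suc (prism_dist m y w)" if "(x, y) \<in> parcs ?G" for x y
    using that w cycle_dist_le_Suc[of "snd x" "snd y" m j]
    by (auto simp: cartesian_product_def)
  show "prism_dist m x w = 0 \<longleftrightarrow> x = w" if "x \<in> pverts ?G" for x
    using that w by (auto simp: cycle_dist_eq_0_iff)
  show "\<exists>y. (x, y) \<in> parcs ?G \<and> prism_dist m x w = Suc (prism_dist m y w)"
    if x0: "x \<in> pverts ?G" "prism_dist m x w \<noteq> 0" for x
  proof -
    obtain a i where x: "x = (a, i)" "a < n" "i < m"
      using x0(1) by auto
    show ?thesis
    proof (cases "a = b")
      case True
      then have "i \<noteq> j" using x0 x w by auto
      then obtain y where "(i, y) \<in> parcs (cycle_graph m)"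
        "cycle_dist m i j = Suc (cycle_dist m y j)"
        using cycle_dist_step x w by metis
      then show ?thesis
        using x w True
        by (intro exI[of _ "(a, y)"]) (auto simp: cartesian_product_def complete_graph_def)
    next
      case False
      then show ?thesis
        using x w
        by (intro exI[of _ "(b, i)"])
          (auto simp: cartesian_product_def complete_graph_def cycle_graph_def)
    qed
  qed
qed

lemma resolving_set_prism_subset:
  "resolving_set (complete_graph n \<box> cycle_graph m) S \<Longrightarrow> S \<subseteq> {0..<n} \<times> {0..<m}"
  by (simp add: resolving_set_def)

lemma resolving_set_prism_iff:
  assumes "m \<ge> 3"
  shows "resolving_set (complete_graph n \<box> cycle_graph m) S \<longleftrightarrow>
    S \<subseteq> {0..<n} \<times> {0..<m} \<and>
    (\<forall>v\<in>{0..<n} \<times> {0..<m}. \<forall>w\<in>{0..<n} \<times> {0..<m}.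
      (\<forall>x\<in>S. prism_dist m v x = prism_dist m w x) \<longrightarrow> v = w)"
proof (cases "S \<subseteq> {0..<n} \<times> {0..<m}")
  case True
  have "resolves (complete_graph n \<box> cycle_graph m) x v w \<longleftrightarrow>
      prism_dist m v x \<noteq> prism_dist m w x"
    if "v \<in> {0..<n} \<times> {0..<m}" "w \<in> {0..<n} \<times> {0..<m}" "x \<in> S" for v w x
  proof -
    have "x \<in> {0..<n} \<times> {0..<m}" using that True by blast
    then show ?thesis
      using that assms by (simp only: resolves_def graph_dist_prism) simp
  qed
  then show ?thesis
    using True unfolding resolving_set_def pverts_prism by blast
next
  case False
  then show ?thesis by (simp add: resolving_set_def)
qed

lemma resolving_set_prismI:
  assumes "m \<ge> 3" "S \<subseteq> {0..<n} \<times> {0..<m}"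
    and "\<And>a u b v. a < n \<Longrightarrow> b < n \<Longrightarrow> u < m \<Longrightarrow> v < m \<Longrightarrow>
      (\<And>x. x \<in> S \<Longrightarrow> prism_dist m (a, u) x = prism_dist m (b, v) x) \<Longrightarrow> a = b \<and> u = v"
  shows "resolving_set (complete_graph n \<box> cycle_graph m) S"
  unfolding resolving_set_prism_iff[OF assms(1)]
proof (intro conjI ballI impI)
  fix v w
  assume "v \<in> {0..<n} \<times> {0..<m}" "w \<in> {0..<n} \<times> {0..<m}"
    and "\<forall>x\<in>S. prism_dist m v x = prism_dist m w x"
  then show "v = w"
    using assms(3)[of "fst v" "fst w" "snd v" "snd w"] by (cases v; cases w) simp
qed fact

lemma resolving_set_prismD:
  assumes "resolving_set (complete_graph n \<box> cycle_graph m) S" "m \<ge> 3"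
    and "a < n" "b < n" "u < m" "v < m"
    and "\<forall>x\<in>S. prism_dist m (a, u) x = prism_dist m (b, v) x"
  shows "a = b \<and> u = v"
proof -
  have "(a, u) \<in> {0..<n} \<times> {0..<m}" "(b, v) \<in> {0..<n} \<times> {0..<m}"
    using assms(3-6) by simp_all
  then have "(a, u) = (b, v)"
    using assms(7) assms(1)[unfolded resolving_set_prism_iff[OF assms(2)]] by blast
  then show ?thesis by simp
qed

section \<open>Upper bounds: explicit resolving sets\<close>

definition alternating_set :: "nat \<Rightarrow> (nat \<times> nat) set" where
  "alternating_set N = (\<lambda>a. (a, a mod 2)) ` {..<N}"

lemma finite_alternating_set: "finite (alternating_set N)"
  by (simp add: alternating_set_def)

lemma card_alternating_set: "card (alternating_set N) = N"
  by (simp add: alternating_set_def card_image inj_on_def)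

lemma ex_same_parity:
  assumes "a < N" "N \<ge> 4"
  shows "\<exists>c<N. c \<noteq> a \<and> c mod 2 = a mod (2::nat)"
proof (cases "a < 2")
  case True
  then show ?thesis using assms by (intro exI[of _ "a + 2"]) auto
next
  case False
  then show ?thesis using assms by (intro exI[of _ "a - 2"]) (auto simp: mod_if)
qed

text \<open>One of the rows 0, 1, 2 avoids both \<open>a\<close> and \<open>b\<close>; as these
  realise both parities, it agrees with one of them. Its element of \<open>alternating_set\<close>
  then shares a column with that of \<open>a\<close> or \<open>b\<close>.\<close>

lemma ex_other_parity_class:
  assumes "a < N" "b < N" "N \<ge> 3" "a mod 2 \<noteq> b mod (2::nat)"
  shows "\<exists>c<N. c \<noteq> a \<and> c \<noteq> b \<and> (c mod 2 = a mod 2 \<or> c mod 2 = b mod 2)"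
proof -
  have "\<not> {0, 1, 2} \<subseteq> {a, b}"
    using card_mono[of "{a, b}" "{0, 1, 2}"] by (auto simp: card_insert_if split: if_splits)
  then obtain c where "c \<in> {0, 1, 2}" "c \<noteq> a" "c \<noteq> b" by blast
  moreover have "c mod 2 = a mod 2 \<or> c mod 2 = b mod 2"
    using assms(4) by (metis mod2_eq_if)
  ultimately show ?thesis
    using assms(3) by (intro exI[of _ c]) auto
qed

lemma resolving_set_alternating:
  assumes m: "m \<ge> 3" and N: "N \<ge> 3" and n: "n = N \<or> n = Suc N \<and> (N \<ge> 4 \<or> even m)"
  shows "resolving_set (complete_graph n \<box> cycle_graph m) (alternating_set N)"
proof (rule resolving_set_prismI[OF m])
  show "alternating_set N \<subseteq> {0..<n} \<times> {0..<m}"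
    using m n by (fastforce simp: alternating_set_def intro: less_le_trans[of _ 2 m])
  fix a u b v
  assume ab: "a < n" "b < n" and uv: "u < m" "v < m"
    and "\<And>x. x \<in> alternating_set N \<Longrightarrow> prism_dist m (a, u) x = prism_dist m (b, v) x"
  then have eq: "of_bool (a \<noteq> c) + cycle_dist m u (c mod 2) =
      of_bool (b \<noteq> c) + cycle_dist m v (c mod 2)" if "c < N" for c
    using that by (fastforce simp: alternating_set_def)
  \<comment> \<open>Row \<open>y\<close> = N holds no element. The element of row \<open>x\<close>
    forces distance to its column to be one larger from \<open>s\<close> than from \<open>t\<close>,
    while every other element forces equal distances from \<open>s\<close> and \<open>t\<close> to
    its own column.\<close>
  have mixed: False
    if xy: "x < N" "y = N" "n = Suc N" "s < m" "t < m"
      and e: "\<And>c. c < N \<Longrightarrow> of_bool (x \<noteq> c) + cycle_dist m s (c mod 2) =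
        of_bool (y \<noteq> c) + cycle_dist m t (c mod 2)" for x y s t
  proof (cases "N \<ge> 4")
    case True
    then obtain c where "c < N" "c \<noteq> x" "c mod 2 = x mod 2"
      using ex_same_parity xy(1) by blast
    then show False using e[of c] e[of x] xy(1,2) by simp
  next
    case False
    then have "even m" using n xy by auto
    \<comment> \<open>With N = 3 the row \<open>x\<close> may be alone in its parity class, so the
      bipartition replaces a second element in the column: equal distances make \<open>s\<close> and
      \<open>t\<close> agree in parity, distances differing by one make them disagree.\<close>
    have parity: "even (cycle_dist m w (c mod 2)) \<longleftrightarrow> even (w + c)" if "w < m" for w c
    proof -
      have "c mod 2 < m" using m mod_less_divisor[of 2 c] by linarith
      then show ?thesis by (simp add: even_cycle_dist \<open>even m\<close> that)
    qed
    obtain c where c: "c < N" "c \<noteq> x"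
      using N by (intro that[of "if x = 0 then 1 else 0"]) auto
    have "cycle_dist m s (c mod 2) = cycle_dist m t (c mod 2)"
      using e[OF c(1)] c xy(2) by simp
    then have "even (s + c) \<longleftrightarrow> even (t + c)"
      by (metis parity xy(4,5))
    moreover have "cycle_dist m s (x mod 2) = Suc (cycle_dist m t (x mod 2))"
      using e[OF xy(1)] xy(1,2) by simp
    then have "even (s + x) \<longleftrightarrow> odd (t + x)"
      by (metis even_Suc parity xy(4,5))
    ultimately show False by auto
  qed
  have "a = b"
  proof (rule ccontr)
    assume "a \<noteq> b"
    consider "a < N" "b < N" | "a < N" "b = N" "n = Suc N" | "a = N" "b < N" "n = Suc N"
      using ab n \<open>a \<noteq> b\<close> by linarith
    then show False
    proof cases
      case 1
      show False
      proof (cases "a mod 2 = b mod 2")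
        case True
        \<comment> \<open>Both elements lie in one column, and each demands that the other vertex be
          strictly closer to it.\<close>
        then show False using eq[of a] eq[of b] 1 \<open>a \<noteq> b\<close> by simp
      next
        case False
        then obtain c where "c < N" "c \<noteq> a" "c \<noteq> b" "c mod 2 = a mod 2 \<or> c mod 2 = b mod 2"
          using ex_other_parity_class 1 N by blast
        then show False using eq[of a] eq[of b] eq[of c] 1 \<open>a \<noteq> b\<close> by auto
      qed
    next
      case 2
      then show False using mixed eq uv by blast
    next
      case 3
      then show False using mixed[of b a v u] eq uv by simp
    qed
  qed
  moreover have "u = v"
    using cycle_dist_0_1_inject[OF m uv] eq[of 0] eq[of 1] N \<open>a = b\<close> by simp
  ultimately show "a = b \<and> u = v" by blast
qed

lemma resolving_set_cycle:
  assumes "m \<ge> 3"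
  shows "resolving_set (complete_graph 1 \<box> cycle_graph m) {(0, 0), (0, 1)}"
proof (rule resolving_set_prismI[OF assms])
  fix a u b v :: nat
  assume "a < 1" "b < 1" "u < m" "v < m"
    and eq: "\<And>x. x \<in> {(0, 0), (0, 1)} \<Longrightarrow> prism_dist m (a, u) x = prism_dist m (b, v) x"
  then show "a = b \<and> u = v"
    using cycle_dist_0_1_inject[OF assms, of u v] eq[of "(0, 0)"] eq[of "(0, 1)"] by auto
qed (use assms in auto)

text \<open>The distances to columns 0 and r add up to r on the columns 0 to r and to r + 1 on the
  others. Adding the two equations therefore rules out different halves by parity; within one half
  it gives equal rows, and then equal columns.\<close>

lemma resolving_set_prism2_odd:
  assumes "m \<ge> 3" "m = Suc (2 * r)"
  shows "resolving_set (complete_graph 2 \<box> cycle_graph m) {(0, 0), (0, r)}"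
proof (rule resolving_set_prismI[OF assms(1)])
  fix a u b v :: nat
  assume *: "a < 2" "b < 2" "u < m" "v < m"
    and eq: "\<And>x. x \<in> {(0, 0), (0, r)} \<Longrightarrow> prism_dist m (a, u) x = prism_dist m (b, v) x"
  define p q :: nat where "p = of_bool (a \<noteq> 0)" and "q = of_bool (b \<noteq> 0)"
  then have pq: "p + cycle_dist m u 0 = q + cycle_dist m v 0"
    "p + cycle_dist m u r = q + cycle_dist m v r"
    using eq[of "(0, 0)"] eq[of "(0, r)"] by auto
  have near: "cycle_dist m x 0 = x \<and> cycle_dist m x r + x = r" if "x \<le> r" for x
    using that assms(2) by (auto simp: cycle_dist_def)
  have far: "cycle_dist m x 0 + x = Suc (2 * r) \<and> cycle_dist m x r + r = x"
    if "r < x" "x < m" for x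
    using that assms(2) by (auto simp: cycle_dist_def)
  have "p = q \<and> u = v"
  proof (cases "u \<le> r"; cases "v \<le> r")
    assume "u \<le> r" "v \<le> r"
    then show ?thesis using pq near[of u] near[of v] by linarith
  next
    assume "u \<le> r" "\<not> v \<le> r"
    then have "2 * p = Suc (2 * q)" using pq near[of u] far[of v] *(4) by linarith
    then show ?thesis by presburger
  next
    assume "\<not> u \<le> r" "v \<le> r"
    then have "2 * q = Suc (2 * p)" using pq near[of v] far[of u] *(3) by linarith
    then show ?thesis by presburger
  next
    assume "\<not> u \<le> r" "\<not> v \<le> r"
    then show ?thesis using pq far[of u] far[of v] *(3,4) by linarith
  qed
  then show "a = b \<and> u = v"
    using *(1,2) by (auto simp: p_def q_def less_2_cases_iff)
qed (use assms in auto)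

text \<open>Columns 0 and r are antipodal, so the two distances add up to r everywhere and their
  elements determine the row; columns 0 and 1 then determine the column.\<close>

lemma resolving_set_prism2_even:
  assumes "m \<ge> 3" "m = 2 * r"
  shows "resolving_set (complete_graph 2 \<box> cycle_graph m) {(0, 0), (0, 1), (0, r)}"
proof (rule resolving_set_prismI[OF assms(1)])
  fix a u b v :: nat
  assume *: "a < 2" "b < 2" "u < m" "v < m"
    and eq: "\<And>x. x \<in> {(0, 0), (0, 1), (0, r)} \<Longrightarrow> prism_dist m (a, u) x = prism_dist m (b, v) x"
  have "cycle_dist m x 0 + cycle_dist m x r = r" if "x < m" for x
    using that assms by (auto simp: cycle_dist_def min_def)
  from this[OF *(3)] this[OF *(4)] have "a = b"
    using eq[of "(0, 0)"] eq[of "(0, r)"] * by (cases "a = 0"; cases "b = 0") auto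
  then show "a = b \<and> u = v"
    using cycle_dist_0_1_inject[OF assms(1) *(3,4)] eq[of "(0, 0)"] eq[of "(0, 1)"] by auto
qed (use assms in auto)

section \<open>Lower bounds: unresolved pairs\<close>

lemma card_fst_resolving_set:
  assumes S: "resolving_set (complete_graph n \<box> cycle_graph m) S" "finite S" and m: "m \<ge> 3"
  shows "n - 1 \<le> card (fst ` S)"
proof -
  have sub: "fst ` S \<subseteq> {0..<n}"
    using resolving_set_prism_subset[OF S(1)] by auto
  have "a = b" if ab: "a \<in> {0..<n} - fst ` S" "b \<in> {0..<n} - fst ` S" for a b
  proof -
    have "\<forall>x\<in>S. prism_dist m (a, 0) x = prism_dist m (b, 0) x"
      using ab by (auto simp: prism_dist_def)
    then show ?thesis
      using resolving_set_prismD[OF S(1) m, of a b 0 0] ab m by simp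
  qed
  then have "card ({0..<n} - fst ` S) \<le> 1"
    by (metis card_le_Suc0_iff_eq finite_Diff finite_atLeastLessThan One_nat_def)
  then show ?thesis
    using card_Diff_subset[of "fst ` S" "{0..<n}"] sub S(2) by simp
qed

text \<open>At least n - 1 rows are occupied, so n - 1 elements cannot share a row.\<close>

lemma resolving_set_distinct_rows:
  assumes S: "resolving_set (complete_graph n \<box> cycle_graph m) S" "finite S"
    and "m \<ge> 3" "card S = n - 1"
  shows "inj_on fst S"
  using card_fst_resolving_set[OF S] assms card_image_le[OF S(2), of fst]
  by (intro eq_card_imp_inj_on) auto

lemma card_resolving_set_prism_ge_2:
  assumes S: "resolving_set (complete_graph n \<box> cycle_graph m) S" "finite S"
    and m: "m \<ge> 3" and n: "n \<ge> 1"
  shows "2 \<le> card S"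
proof (rule ccontr)
  assume "\<not> 2 \<le> card S"
  then have "card S = 0 \<or> card S = 1" by linarith
  then consider "S = {}" | a i where "S = {(a, i)}"
    using S(2) by (auto simp: card_1_singleton_iff)
  then show False
  proof cases
    case 1
    then show False
      using resolving_set_prismD[OF S(1) m, of 0 0 0 1] m n by simp
  next
    case 2
    then have "a < n" "i < m"
      using resolving_set_prism_subset[OF S(1)] 2 by auto
    then show False
      using resolving_set_prismD[OF S(1) m, of a a] cycle_dist_two_neighbours[OF m, of i] 2
      by fastforce
  qed
qed

text \<open>For equal columns, the two neighbours of \<open>(a, i)\<close> in its row are
  unresolved. Otherwise let \<open>x\<close> be the neighbour of \<open>i\<close> towards
  \<open>j\<close>: both \<open>(b, i)\<close> and \<open>(a, x)\<close> are at distance 1 from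
  \<open>(a, i)\<close>, and changing row costs \<open>(a, x)\<close> exactly the step it has gained
  towards \<open>(b, j)\<close>.\<close>

lemma not_resolving_two_rows:
  assumes m: "m \<ge> 3" and "a \<noteq> b"
  shows "\<not> resolving_set (complete_graph n \<box> cycle_graph m) {(a, i), (b, j)}"
proof
  assume S: "resolving_set (complete_graph n \<box> cycle_graph m) {(a, i), (b, j)}"
  then have *: "a < n" "b < n" "i < m" "j < m"
    using resolving_set_prism_subset[OF S] by auto
  show False
  proof (cases "i = j")
    case True
    then show False
      using resolving_set_prismD[OF S m, of a a] cycle_dist_two_neighbours[OF m, of i] *
      by fastforce
  next
    case False
    then obtain x where "(i, x) \<in> parcs (cycle_graph m)"
      "cycle_dist m i j = Suc (cycle_dist m x j)"
      using cycle_dist_step * by metis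
    moreover from this have "x < m" "cycle_dist m x i = 1"
      using cycle_dist_arc[OF _ m] by (auto simp: cycle_graph_def)
    ultimately show False
      using resolving_set_prismD[OF S m, of b a i x] * \<open>a \<noteq> b\<close> by auto
  qed
qed

lemma not_resolving_one_row_even:
  assumes m: "m \<ge> 3" "even m" and n: "n \<ge> 2" and "i \<noteq> j"
  shows "\<not> resolving_set (complete_graph n \<box> cycle_graph m) {(a, i), (a, j)}"
proof
  assume S: "resolving_set (complete_graph n \<box> cycle_graph m) {(a, i), (a, j)}"
  then have *: "a < n" "i < m" "j < m"
    using resolving_set_prism_subset[OF S] by auto
  have "\<exists>b<n. b \<noteq> a"
    using n by (intro exI[of _ "if a = 0 then 1 else 0"]) auto
  then obtain b where b: "b < n" "b \<noteq> a" by blast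
  from m(2,1) *(2,3) \<open>i \<noteq> j\<close> show False
  proof (cases rule: even_cycle_dist_pair)
    case (antipodal p q)
    then show False
      using resolving_set_prismD[OF S m(1), of a a p q] * by auto
  next
    case (away p)
    \<comment> \<open>The vertices \<open>(a, p)\<close> and \<open>(b, i)\<close> both have
      distance 1 to the first element and one more than the cycle distance of \<open>i\<close> and
      \<open>j\<close> to the second.\<close>
    then show False
      using resolving_set_prismD[OF S m(1), of a b p i] * b by auto
  qed
qed

lemma not_resolving_opposite_halves:
  assumes m: "m = Suc (2 * r)" "m \<ge> 3" and abc: "a \<noteq> b" "a \<noteq> c" "b \<noteq> c"
    and "i \<noteq> k" "j \<noteq> k" and h: "half_cycle r k i" "\<not> half_cycle r k j"
  shows "\<not> resolving_set (complete_graph n \<box> cycle_graph m) {(a, i), (b, j), (c, k)}"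
proof
  assume S: "resolving_set (complete_graph n \<box> cycle_graph m) {(a, i), (b, j), (c, k)}"
  then have *: "a < n" "b < n" "c < n" "i < m" "j < m" "k < m"
    using resolving_set_prism_subset[OF S] by auto
  obtain u v where uv: "u < m" "v < m" "u \<noteq> v" "cycle_dist m u k = cycle_dist m v k"
    "cycle_dist m v i = Suc (cycle_dist m u i)" "cycle_dist m u j = Suc (cycle_dist m v j)"
    using odd_cycle_opposite_edge[of m r k] m * assms
    by (metis (no_types, lifting) One_nat_def Suc_le_mono le_zero_eq mult_0_right not_gr_zero
        numeral_3_eq_3 nat.distinct(1))
  \<comment> \<open>For \<open>(b, u)\<close> and \<open>(a, v)\<close> the row changes to
    \<open>(a, i)\<close> and \<open>(b, j)\<close> balance the unit differences of the cycle
    distances; the third row and column \<open>k\<close> treat both vertices alike.\<close>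
  show False
    using resolving_set_prismD[OF S m(2), of b a u v] * uv abc by auto
qed

text \<open>With four rows some row \<open>e\<close> is free. The edge opposite to \<open>k\<close>
  has ends equidistant from \<open>k\<close> whose distances to \<open>i\<close> differ by one;
  putting the farther end in row \<open>a\<close> and the nearer in row \<open>e\<close> cancels
  that difference. If \<open>i = k\<close>, the neighbours of \<open>(a, i)\<close> in its row
  suffice.\<close>

lemma not_resolving_three_rows_odd_coincident:
  assumes m: "m = Suc (2 * r)" "m \<ge> 3" and n: "n \<ge> 4" and abc: "a \<noteq> b" "a \<noteq> c" "b \<noteq> c"
  shows "\<not> resolving_set (complete_graph n \<box> cycle_graph m) {(a, i), (b, k), (c, k)}"
proof
  assume S: "resolving_set (complete_graph n \<box> cycle_graph m) {(a, i), (b, k), (c, k)}"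
  then have *: "a < n" "b < n" "c < n" "i < m" "k < m"
    using resolving_set_prism_subset[OF S] by auto
  have "\<not> {0..<n} \<subseteq> {a, b, c}"
    using card_mono[of "{a, b, c}" "{0..<n}"] n abc by auto
  then obtain e where "e \<in> {0..<n}" "e \<notin> {a, b, c}"
    by blast
  then have e: "e < n" "e \<noteq> a" "e \<noteq> b" "e \<noteq> c"
    by simp_all
  have r: "r > 0" using m by simp
  show False
  proof (cases "i = k")
    case True
    then show False
      using resolving_set_prismD[OF S m(2), of a a] cycle_dist_two_neighbours[OF m(2), of i] *
      by fastforce
  next
    case False
    obtain u v where uv: "u < m" "v < m" "cycle_dist m u k = cycle_dist m v k"
      "cycle_dist m v i = Suc (cycle_dist m u i) \<or> cycle_dist m u i = Suc (cycle_dist m v i)"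
      using odd_cycle_opposite_edge[OF m(1) r *(5)] False * by metis
    then show False
      using resolving_set_prismD[OF S m(2), of a e v u] resolving_set_prismD[OF S m(2), of a e u v]
        * e abc by auto
  qed
qed

lemma not_resolving_three_rows_odd:
  assumes m: "m \<ge> 3" "odd m" and n: "n \<ge> 4" and abc: "a \<noteq> b" "a \<noteq> c" "b \<noteq> c"
  shows "\<not> resolving_set (complete_graph n \<box> cycle_graph m) {(a, i), (b, j), (c, k)}"
proof
  assume S: "resolving_set (complete_graph n \<box> cycle_graph m) {(a, i), (b, j), (c, k)}"
  then have *: "i < m" "j < m" "k < m"
    using resolving_set_prism_subset[OF S] by auto
  obtain r where r: "m = Suc (2 * r)"
    using m(2) by (auto elim: oddE)
  have perm: "{(a, i), (b, j), (c, k)} = {(b, j), (a, i), (c, k)}"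
    "{(a, i), (b, j), (c, k)} = {(c, k), (a, i), (b, j)}"
    "{(a, i), (b, j), (c, k)} = {(a, i), (c, k), (b, j)}"
    "{(a, i), (b, j), (c, k)} = {(b, j), (c, k), (a, i)}"
    "{(a, i), (b, j), (c, k)} = {(c, k), (b, j), (a, i)}"
    by auto
  have distinct: "i \<noteq> j" "i \<noteq> k" "j \<noteq> k"
    using S not_resolving_three_rows_odd_coincident[OF r m(1) n] abc perm by metis+
  note opp = not_resolving_opposite_halves[OF r m(1)]
  \<comment> \<open>Some column has the other two in different halves. Each case below uses two
    instances of \<open>opp\<close>, according to which of the two lies in the half ahead.\<close>
  from half_cycle_separates[of i r j k] * r distinct
  consider "half_cycle r k i \<noteq> half_cycle r k j" | "half_cycle r i j \<noteq> half_cycle r i k"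
    | "half_cycle r j i \<noteq> half_cycle r j k" by auto
  then show False
  proof cases
    case 1
    then show False using S opp[of a b c i k j n] opp[of b a c j k i n] abc distinct perm by metis
  next
    case 2
    then show False using S opp[of b c a j i k n] opp[of c b a k i j n] abc distinct perm by metis
  next
    case 3
    then show False using S opp[of a c b i j k n] opp[of c a b k j i n] abc distinct perm by metis
  qed
qed

section \<open>Assembling the values\<close>

lemma metric_dimension_eqI:
  assumes "finite S" "resolving_set G S" "card S = k"
    and "\<And>T. finite T \<Longrightarrow> resolving_set G T \<Longrightarrow> k \<le> card T"
  shows "metric_dimension G = k"
  unfolding metric_dimension_def using assms by (intro Least_equality) auto

theorem theorem8p5:
  fixes n m :: nat
  assumes "n \<ge> 1" and "m \<ge> 3"
  shows "metric_dimension (complete_graph n \<box> cycle_graph m) =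
    (if n = 1 then 2
     else if n = 2 \<and> odd m then 2
     else if n = 2 \<and> even m then 3
     else if n = 3 then 3
     else if n = 4 \<and> even m then 3
     else if n = 4 \<and> odd m then 4
     else n - 1)"
proof -
  let ?G = "complete_graph n \<box> cycle_graph m"
  note m = \<open>m \<ge> 3\<close>
  note ge2 = card_resolving_set_prism_ge_2[OF _ _ m \<open>n \<ge> 1\<close>]
  have rows: "n - 1 \<le> card T" if "finite T" "resolving_set ?G T" for T
    using card_fst_resolving_set[OF that(2,1) m] card_image_le[OF that(1), of fst] by linarith
  \<comment> \<open>Covers every \<open>n \<ge> 3\<close>: used with N = n for \<open>n = 3\<close>
    and for \<open>n = 4\<close> with odd \<open>m\<close>, and with N = n - 1 otherwise.\<close>
  have alt: "metric_dimension ?G = N"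
    if "N \<ge> 3" "n = N \<or> n = Suc N \<and> (N \<ge> 4 \<or> even m)"
      and "\<And>T. finite T \<Longrightarrow> resolving_set ?G T \<Longrightarrow> N \<le> card T" for N
    using that resolving_set_alternating[OF m]
    by (intro metric_dimension_eqI[OF finite_alternating_set _ card_alternating_set]) auto
  consider "n = 1" | "n = 2" "odd m" | "n = 2" "even m" | "n = 3" | "n = 4" "even m"
    | "n = 4" "odd m" | "n \<ge> 5"
    using assms by linarith
  then show ?thesis
  proof cases
    case 1
    have "metric_dimension ?G = 2"
      by (rule metric_dimension_eqI[of "{(0, 0), (0, 1)}"])
        (use 1 resolving_set_cycle[OF m] ge2 in auto)
    then show ?thesis using 1 by simp
  next
    case 2
    then obtain r where r: "m = Suc (2 * r)" by (auto elim: oddE)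
    have "metric_dimension ?G = 2"
      by (rule metric_dimension_eqI[of "{(0, 0), (0, r)}"])
        (use 2 m r resolving_set_prism2_odd[OF m r] ge2 in auto)
    then show ?thesis using 2 by simp
  next
    case 3
    then obtain r where r: "m = 2 * r" by (auto elim: evenE)
    have "metric_dimension ?G = 3"
    proof (rule metric_dimension_eqI[of "{(0, 0), (0, 1), (0, r)}"])
      fix T assume T: "finite T" "resolving_set ?G T"
      have "card T \<noteq> 2"
      proof
        assume "card T = 2"
        then obtain a i b j where "T = {(a, i), (b, j)}" "(a, i) \<noteq> (b, j)"
          by (metis card_2_iff surj_pair)
        then show False
          using T not_resolving_two_rows[OF m, of a b n i j]
            not_resolving_one_row_even[OF m, of n i j a] 3 by (cases "a = b") auto
      qed
      then show "3 \<le> card T" using ge2[OF T(2,1)] by linarith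
    qed (use 3 m r resolving_set_prism2_even[OF m r] in auto)
    then show ?thesis using 3 by simp
  next
    case 4
    have "3 \<le> card T" if T: "finite T" "resolving_set ?G T" for T
    proof -
      have "card T \<noteq> 2"
      proof
        assume c: "card T = 2"
        then obtain a i b j where ab: "T = {(a, i), (b, j)}" "(a, i) \<noteq> (b, j)"
          by (metis card_2_iff surj_pair)
        moreover have "inj_on fst T"
          using resolving_set_distinct_rows[OF T(2,1) m] c 4 by simp
        ultimately have "a \<noteq> b" by auto
        then show False
          using T not_resolving_two_rows[OF m, of a b n i j] ab by auto
      qed
      then show ?thesis using ge2[OF T(2,1)] by linarith
    qed
    then show ?thesis using alt[of 3] 4 by simp
  next
    case 5
    then show ?thesis using alt[of 3] rows by simp
  next
    case 6
    have "4 \<le> card T" if T: "finite T" "resolving_set ?G T" for T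
    proof -
      have "card T \<noteq> 3"
      proof
        assume c: "card T = 3"
        then obtain a i b j d k where ab: "T = {(a, i), (b, j), (d, k)}"
          "(a, i) \<noteq> (b, j)" "(a, i) \<noteq> (d, k)" "(b, j) \<noteq> (d, k)"
          by (metis card_3_iff surj_pair)
        moreover have "inj_on fst T"
          using resolving_set_distinct_rows[OF T(2,1) m] c 6 by simp
        ultimately have "a \<noteq> b" "a \<noteq> d" "b \<noteq> d" by auto
        then show False
          using T not_resolving_three_rows_odd[OF m, of n a b d i j k] ab 6 by auto
      qed
      then show ?thesis using rows[OF T] 6 by linarith
    qed
    then show ?thesis using alt[of 4] 6 by simp
  next
    case 7
    then have "n = Suc (n - 1)" "n - 1 \<ge> 4" by simp_all
    then show ?thesis using alt[of "n - 1"] rows 7 by simp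
  qed
qed

end
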